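(* Let $A$ be an abelian group, and let $C=(c_\alpha)_{\alpha<\iota}$ be a well-ordered semiminimal family of $\operatorname{Dih}(A)$, indexed by an arbitrary ordinal $\iota$, containing at least one reflection. Write $c_\alpha=(a_\alpha,\varepsilon_\alpha)$ with $a_\alpha\in A$, $\varepsilon_\alpha\in\{0,1\}$ for each $\alpha<\iota$, and let $s<\iota$ be the least index with $\varepsilon_s=1$. Define the family of elements of $A$ $$D:=(d_\alpha)_{\alpha<\iota,\ \alpha\neq s},\qquad d_\alpha:=a_\alpha-\varepsilon_\alpha a_s,$$ with the inherited order. If $r:=r(D)$ denotes the order of $D$, then $$\chi_c(\operatorname{Cay}(\operatorname{Dih}(A),C))\leq\begin{cases}2,&\text{if } r=\infty,\\[1mm] \dfrac{2r}{r-1},&\text{if } r\in\mathbb N.\end{cases}$$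
   Context: For an abelian group $A$, the generalized dihedral group $\operatorname{Dih}(A)=A\rtimes C_2$ (the nontrivial element of the cyclic group $C_2$ of order 2 acting by inversion) consists of pairs $(a,\varepsilon)$, $a\in A$, $\varepsilon\in\{0,1\}$, with multiplication $(a,\varepsilon)(b,\delta)=(a+(-1)^\varepsilon b,\varepsilon+\delta)$, second coordinate modulo $2$. Elements of $A\times\{0\}$ are rotations; elements of $A\times\{1\}$ are reflections. A semiminimal family of a group $G$ is a family $(c_\alpha)_{\alpha<\iota}$ of elements of $G$ indexed by an ordinal $\iota$ (not necessarily generating $G$) such that $c_\alpha\notin\langle c_\beta:\beta<\alpha\rangle$ for every $\alpha<\iota$. For a well-ordered family $D=(d_\alpha)$ of elements of an abelian group $A$, put $H_\alpha:=\langle d_\beta:\beta<\alpha\rangle$ (with $\beta$ ranging over the index set of $D$). The relative order of $d_\alpha$ in $D$ is $r_\alpha:=\operatorname{ord}_{A/H_\alpha}(d_\alpha+H_\alpha)\in\mathbb Z_{>0}\cup\{\infty\}$. The order of $D$ is $r(D):=\min_\alpha r_\alpha$, with $r(\varnothing):=\infty$. For a group $G$ and a family $C$ of elements of $G$, the undirected Cayley graph $\operatorname{Cay}(G,C)$ has vertex set $G$, with two distinct elements $a,b$ adjacent whenever $a^{-1}b\in C\cup C^{-1}$. $C$ is not required to generate $G$. The circular chromatic number $\chi_c(X)$ of a (possibly infinite) graph $X=(V,E)$ is the infimum of all real $s\ge 1$ for which there is a map $f:V\to\mathbb R/\mathbb Z$ such that for every edge $\{u,v\}$ the circular distance $\|f(u)-f(v)\|$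 is at least $1/s$, where $\|x\|$ is the distance from $x\in\mathbb R/\mathbb Z$ to $0$ on the circle of circumference $1$; the infimum of the empty set is $\infty$. *)

theory Defs
  imports
    "HOL-Algebra.Multiplicative_Group"
    "HOL-Algebra.Generated_Groups"
    "HOL-Library.Extended_Nat"
    "HOL-Library.Extended_Real"
    "HOL-Analysis.Elementary_Metric_Spaces"
begin

text \<open>
  The second coordinate is a truth value: \<open>True\<close> stands for 1 (a reflection) and \<open>False\<close> for 0
  (a rotation), so that addition modulo 2 is \<open>\<noteq>\<close>. Groups, including the abelian group \<open>A\<close>, are
  written multiplicatively, as in HOL-Algebra.
\<close>

definition Dih :: "('a, 'm) monoid_scheme \<Rightarrow> ('a \<times> bool) monoid" where
  "Dih A =
    \<lparr>carrier = carrier A \<times> UNIV,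
     mult = (\<lambda>(a, \<epsilon>) (b, \<delta>). (a \<otimes>\<^bsub>A\<^esub> (if \<epsilon> then inv\<^bsub>A\<^esub> b else b), \<epsilon> \<noteq> \<delta>)),
     one = (\<one>\<^bsub>A\<^esub>, False)\<rparr>"

lemma (in comm_group) group_Dih: "group (Dih G)"
proof (rule groupI)
  fix x assume "x \<in> carrier (Dih G)"
  then obtain a e where x: "x = (a, e)" "a \<in> carrier G"
    by (auto simp: Dih_def)
  show "\<exists>y\<in>carrier (Dih G). y \<otimes>\<^bsub>Dih G\<^esub> x = \<one>\<^bsub>Dih G\<^esub>"
    by (rule bexI[of _ "(if e then a else inv a, e)"]) (use x in \<open>auto simp: Dih_def\<close>)
qed (auto simp: Dih_def m_assoc inv_mult split: if_splits)

text \<open>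
  A family indexed by an ordinal is a function \<open>c\<close> together with a reflexive well-order \<open>W\<close>; the
  index set is \<open>Field W\<close> (values of \<open>c\<close> outside it are irrelevant), and \<open>underS W \<alpha>\<close> is the set of
  indices strictly below \<open>\<alpha>\<close>.
\<close>

definition initial_span ::
  "('a, 'm) monoid_scheme \<Rightarrow> 'i rel \<Rightarrow> ('i \<Rightarrow> 'a) \<Rightarrow> 'i \<Rightarrow> 'a set" where
  "initial_span G W c \<alpha> = generate G (c ` underS W \<alpha>)"

definition semiminimal_family ::
  "('a, 'm) monoid_scheme \<Rightarrow> 'i rel \<Rightarrow> ('i \<Rightarrow> 'a) \<Rightarrow> bool" where
  "semiminimal_family G W c \<longleftrightarrow>
     Well_order W \<and> c ` Field W \<subseteq> carrier G \<and>
     (\<forall>\<alpha>\<in>Field W. c \<alpha> \<notin> initial_span G W c \<alpha>)"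

text \<open>\<open>group.ord\<close> takes the value 0 on elements of infinite order.\<close>

definition element_order :: "('a, 'm) monoid_scheme \<Rightarrow> 'a \<Rightarrow> enat" where
  "element_order G x = (if group.ord G x = 0 then \<infinity> else enat (group.ord G x))"

definition relative_order ::
  "('a, 'm) monoid_scheme \<Rightarrow> 'i rel \<Rightarrow> ('i \<Rightarrow> 'a) \<Rightarrow> 'i \<Rightarrow> enat" where
  "relative_order A W d \<alpha> =
     (let H = initial_span A W d \<alpha> in element_order (A Mod H) (H #>\<^bsub>A\<^esub> d \<alpha>))"

text \<open>In \<^typ>\<open>enat\<close> the infimum of a nonempty set is its minimum, and that of the empty set is \<open>\<infinity>\<close>.\<close>

definition family_order :: "('a, 'm) monoid_scheme \<Rightarrow> 'i rel \<Rightarrow> ('i \<Rightarrow> 'a) \<Rightarrow> enat" where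
  "family_order A W d = (INF \<alpha>\<in>Field W. relative_order A W d \<alpha>)"

definition reduced_family ::
  "('a, 'm) monoid_scheme \<Rightarrow> ('i \<Rightarrow> 'a \<times> bool) \<Rightarrow> 'i \<Rightarrow> 'i \<Rightarrow> 'a" where
  "reduced_family A c s \<alpha> =
     fst (c \<alpha>) \<otimes>\<^bsub>A\<^esub> (if snd (c \<alpha>) then inv\<^bsub>A\<^esub> (fst (c s)) else \<one>\<^bsub>A\<^esub>)"

text \<open>A graph is a pair of a vertex set and a set of two-element edges.\<close>

type_synonym 'v graph = "'v set \<times> 'v set set"

definition Cay :: "('a, 'm) monoid_scheme \<Rightarrow> 'a set \<Rightarrow> 'a graph" where
  "Cay G S =
     (carrier G,
      {{a, b} | a b. a \<in> carrier G \<and> b \<in> carrier G \<and> a \<noteq> b \<and>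
         inv\<^bsub>G\<^esub> a \<otimes>\<^bsub>G\<^esub> b \<in> S \<union> m_inv G ` S})"

quotient_type circle = real / "\<lambda>x y :: real. x - y \<in> \<int>"
proof (rule equivpI)
  show "reflp (\<lambda>x y :: real. x - y \<in> \<int>)"
    by (simp add: reflp_def)
  show "symp (\<lambda>x y :: real. x - y \<in> \<int>)"
  proof (rule sympI)
    fix x y :: real assume "x - y \<in> \<int>"
    then have "- (x - y) \<in> \<int>" by (rule Ints_minus)
    then show "y - x \<in> \<int>" by simp
  qed
  show "transp (\<lambda>x y :: real. x - y \<in> \<int>)"
  proof (rule transpI)
    fix x y z :: real assume "x - y \<in> \<int>" "y - z \<in> \<int>"
    then have "(x - y) + (y - z) \<in> \<int>" by (rule Ints_add)
    then show "x - z \<in> \<int>" by simp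
  qed
qed

instantiation circle :: ab_group_add
begin

lift_definition zero_circle :: circle is "0 :: real" .

lift_definition plus_circle :: "circle \<Rightarrow> circle \<Rightarrow> circle" is "(+) :: real \<Rightarrow> real \<Rightarrow> real"
proof -
  fix x x' y y' :: real assume "x - x' \<in> \<int>" "y - y' \<in> \<int>"
  then have "(x - x') + (y - y') \<in> \<int>" by (rule Ints_add)
  then show "(x + y) - (x' + y') \<in> \<int>" by (simp add: algebra_simps)
qed

lift_definition uminus_circle :: "circle \<Rightarrow> circle" is "uminus :: real \<Rightarrow> real"
proof -
  fix x y :: real assume "x - y \<in> \<int>"
  then have "- (x - y) \<in> \<int>" by (rule Ints_minus)
  then show "- x - - y \<in> \<int>" by simp
qed

lift_definition minus_circle :: "circle \<Rightarrow> circle \<Rightarrow> circle" is "(-) :: real \<Rightarrow> real \<Rightarrow> real"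
proof -
  fix x x' y y' :: real assume "x - x' \<in> \<int>" "y - y' \<in> \<int>"
  then have "(x - x') - (y - y') \<in> \<int>" by (rule Ints_diff)
  then show "(x - y) - (x' - y') \<in> \<int>" by (simp add: algebra_simps)
qed

instance
  by standard (transfer; simp add: algebra_simps)+

end

text \<open>The distance to 0 on the circle is the distance of any representative to the integers.\<close>

lift_definition circle_norm :: "circle \<Rightarrow> real" is "\<lambda>x. infdist x \<int>"
proof -
  have le: "infdist x \<int> \<le> infdist y \<int>" if "x - y \<in> \<int>" for x y :: real
  proof -
    have "infdist x \<int> \<le> dist y n" if n: "n \<in> \<int>" for n
    proof -
      have "n + (x - y) \<in> \<int>" using n \<open>x - y \<in> \<int>\<close> by (rule Ints_add)
      then have "infdist x \<int> \<le> dist x (n + (x - y))" by (rule infdist_le)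
      then show ?thesis by (simp add: dist_real_def)
    qed
    moreover have "(\<int> :: real set) \<noteq> {}" using Ints_0 by blast
    ultimately show ?thesis
      by (simp add: infdist_def[of y] cINF_greatest)
  qed
  fix x y :: real assume "x - y \<in> \<int>"
  moreover have "y - x \<in> \<int>"
    using Ints_minus[OF \<open>x - y \<in> \<int>\<close>] by simp
  ultimately show "infdist x \<int> = infdist y \<int>" by (intro antisym le)
qed

definition circular_coloring :: "'v graph \<Rightarrow> real \<Rightarrow> ('v \<Rightarrow> circle) \<Rightarrow> bool" where
  "circular_coloring X s f \<longleftrightarrow>
     (\<forall>u v. {u, v} \<in> snd X \<longrightarrow> circle_norm (f u - f v) \<ge> 1 / s)"

definition circular_chromatic_number :: "'v graph \<Rightarrow> ereal" (\<open>\<chi>\<^sub>c\<close>) where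
  "\<chi>\<^sub>c X = Inf {ereal s | s. s \<ge> 1 \<and> (\<exists>f. circular_coloring X s f)}"

end

theory Submission
  imports Defs
begin

text \<open>
  Write \<open>A\<close> additively. The map \<open>(a, \<epsilon>) \<mapsto> (a - \<epsilon> a\<^sub>s, \<epsilon>)\<close> is an automorphism of \<open>Dih A\<close> that
  turns \<open>c\<^sub>s\<close> into \<open>(0, 1)\<close> and every other \<open>c\<^sub>\<alpha>\<close> into \<open>(d\<^sub>\<alpha>, \<epsilon>\<^sub>\<alpha>)\<close>. Suppose that \<open>\<phi>\<close> is a character,
  that is, a homomorphism to \<open>\<real>/\<int>\<close>. If, in the new coordinates, \<open>(b, \<epsilon>)\<close> is given the colour
  \<open>\<phi> b + \<epsilon>/2\<close>, then the two ends of an edge labelled \<open>(d, \<epsilon>)\<close> have colours that differ by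
  \<open>\<plusminus> (\<phi> d + \<epsilon>/2)\<close>. A good colouring therefore results from a character whose value at each \<open>d\<^sub>\<alpha>\<close> is
  close to \<open>1/2\<close> if \<open>c\<^sub>\<alpha>\<close> is a rotation and close to \<open>0\<close> if \<open>c\<^sub>\<alpha>\<close> is a reflection; the label \<open>c\<^sub>s\<close>
  itself always yields the optimal distance \<open>1/2\<close>.

  Such a character is built along the well-order. Once it is defined on \<open>H\<^sub>\<alpha>\<close>, its admissible values
  at \<open>d\<^sub>\<alpha>\<close> are the solutions \<open>y\<close> of \<open>r\<^sub>\<alpha> y = \<phi> (r\<^sub>\<alpha> d\<^sub>\<alpha>)\<close>. They are spaced \<open>1/r\<^sub>\<alpha>\<close> apart on the circle,
  so one of them is within \<open>1/(2 r\<^sub>\<alpha>)\<close> of the target; for \<open>r\<^sub>\<alpha> = \<infinity>\<close> every value is admissible and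
  the target can be hit exactly (\<open>character_graph_extend\<close>). Zorn's lemma carries out the transfinite
  construction (\<open>character_graph_near_targets\<close>). It gives a character on the span of the \<open>d\<^sub>\<alpha>\<close> only,
  but the colouring just needs a function on \<open>A\<close> with the right increments along that span, which a
  choice of coset representatives provides (\<open>character_graph_potential\<close>).

  All distances are then at least \<open>1/2 - 1/(2 r) = (r - 1)/(2 r)\<close>, respectively \<open>1/2\<close>
  (\<open>circular_coloring_Cay_Dih\<close>). Semiminimality enters through \<open>r \<ge> 2\<close>: it passes from \<open>C\<close> to \<open>D\<close>
  (\<open>reduced_family_semiminimal\<close>), so that no \<open>r\<^sub>\<alpha>\<close> is 1.
\<close>

section \<open>Real-valued lifts of partial characters\<close>

context comm_group
begin

text \<open>
  The graph of a homomorphism \<open>\<phi>\<close> from a subgroup of the group to \<open>\<real>/\<int>\<close>, encoded as the set of all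
  pairs \<open>(x, u)\<close> such that the real number \<open>u\<close> represents \<open>\<phi> x\<close>: a subgroup of the product with
  the additive group of reals whose fibre over the unit is \<open>\<int>\<close>. Domains grow by inclusion of graphs,
  and an admissible value can be chosen as close to a target as a real number.
\<close>

definition character_graph :: "('a \<times> real) set \<Rightarrow> bool" where
  "character_graph g \<longleftrightarrow>
     g \<subseteq> carrier G \<times> UNIV \<and> (\<forall>u. (\<one>, u) \<in> g \<longleftrightarrow> u \<in> \<int>) \<and>
     (\<forall>x u y v. (x, u) \<in> g \<longrightarrow> (y, v) \<in> g \<longrightarrow> (x \<otimes> inv y, u - v) \<in> g)"

lemma character_graphD:
  assumes "character_graph g"
  shows "(x, u) \<in> g \<Longrightarrow> x \<in> carrier G"
    and "(\<one>, u) \<in> g \<longleftrightarrow> u \<in> \<int>"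
    and "(x, u) \<in> g \<Longrightarrow> (y, v) \<in> g \<Longrightarrow> (x \<otimes> inv y, u - v) \<in> g"
  using assms unfolding character_graph_def by blast+

lemma character_graph_inv:
  assumes "character_graph g" "(x, u) \<in> g"
  shows "(inv x, - u) \<in> g"
  using character_graphD(3)[OF assms(1), of \<one> 0 x u] character_graphD(1,2)[OF assms(1)] assms(2)
  by simp

lemma character_graph_mult:
  assumes "character_graph g" "(x, u) \<in> g" "(y, v) \<in> g"
  shows "(x \<otimes> y, u + v) \<in> g"
  using character_graphD(3)[OF assms(1,2) character_graph_inv[OF assms(1,3)]]
    character_graphD(1)[OF assms(1,3)] by simp

lemma character_graph_nat_pow:
  assumes "character_graph g" "(x, u) \<in> g"
  shows "(x [^] (m :: nat), of_nat m * u) \<in> g"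
proof (induction m)
  case 0
  then show ?case using character_graphD(2)[OF assms(1)] by simp
next
  case (Suc m)
  show ?case using character_graph_mult[OF assms(1) Suc assms(2)] by (simp add: algebra_simps)
qed

lemma character_graph_int_pow:
  assumes "character_graph g" "(x, u) \<in> g"
  shows "(x [^] (m :: int), of_int m * u) \<in> g"
proof (cases m rule: int_cases2)
  case (nonneg k)
  then show ?thesis using character_graph_nat_pow[OF assms, of k] by (simp add: int_pow_int)
next
  case (nonpos k)
  then show ?thesis
    using character_graph_inv[OF assms(1) character_graph_nat_pow[OF assms, of k]]
      character_graphD(1)[OF assms] by (simp add: int_pow_neg_int)
qed

lemma character_graph_diff_Ints:
  assumes "character_graph g" "(x, u) \<in> g" "(x, v) \<in> g"
  shows "u - v \<in> \<int>"
  using character_graphD(3)[OF assms] character_graphD(1,2)[OF assms(1)] assms(2) by simp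

lemma character_graph_near:
  assumes "character_graph g" "(x, u) \<in> g"
  obtains y where "(x, y) \<in> g" "\<bar>y - t\<bar> \<le> 1 / 2"
proof
  have "(\<one>, of_int (round (t - u))) \<in> g"
    using character_graphD(2)[OF assms(1)] by simp
  from character_graph_mult[OF assms this]
  show "(x, u + of_int (round (t - u))) \<in> g"
    using character_graphD(1)[OF assms] by simp
  show "\<bar>u + of_int (round (t - u)) - t\<bar> \<le> 1 / 2"
    using of_int_round_abs_le[of "t - u"] by linarith
qed

lemma character_graph_singleton: "character_graph ({\<one>} \<times> \<int>)"
  by (auto simp: character_graph_def)

lemma character_graph_Union:
  assumes "C \<noteq> {}" "\<And>g. g \<in> C \<Longrightarrow> character_graph g"
    and chain: "\<And>g h. g \<in> C \<Longrightarrow> h \<in> C \<Longrightarrow> g \<subseteq> h \<or> h \<subseteq> g"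
  shows "character_graph (\<Union>C)"
  unfolding character_graph_def
proof (intro conjI allI impI)
  show "\<Union>C \<subseteq> carrier G \<times> UNIV"
    using assms(2) unfolding character_graph_def by blast
  show "(\<one>, u) \<in> \<Union>C \<longleftrightarrow> u \<in> \<int>" for u
    using assms(1) character_graphD(2)[OF assms(2)] by auto
  fix x u y v assume "(x, u) \<in> \<Union>C" "(y, v) \<in> \<Union>C"
  then obtain g h where "g \<in> C" "h \<in> C" "(x, u) \<in> g" "(y, v) \<in> h" by blast
  with chain obtain k where "k \<in> C" "(x, u) \<in> k" "(y, v) \<in> k" by blast
  then show "(x \<otimes> inv y, u - v) \<in> \<Union>C"
    using character_graphD(3)[OF assms(2)] by blast
qed

text \<open>
  Extending a character from a subgroup \<open>K\<close> to the subgroup generated by \<open>K\<close> and \<open>x\<close>, where \<open>n\<close> is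
  the order of \<open>x\<close> modulo \<open>K\<close>, with \<open>n = 0\<close> for infinite order. Any \<open>y\<close> for which \<open>n y\<close> represents
  the value at \<open>x\<^sup>n\<close> is consistent with the values on \<open>K\<close>, and rounding selects one near \<open>t\<close>. For
  \<open>n = 0\<close> the bound \<open>1 / (2 * real n)\<close> is \<open>0\<close>, which is the exact statement in that case too.
\<close>

lemma character_graph_extend:
  fixes t :: real and n :: nat
  assumes g: "character_graph g" and x: "x \<in> carrier G"
    and n: "\<And>k :: int. x [^] k \<in> Domain g \<longleftrightarrow> int n dvd k"
  obtains g' y where "character_graph g'" "g \<subseteq> g'" "(x, y) \<in> g'" "\<bar>y - t\<bar> \<le> 1 / (2 * real n)"
    "Domain g' \<subseteq> {x [^] (k :: int) \<otimes> h | k h. h \<in> Domain g}"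
proof -
  \<comment> \<open>Pick the representative \<open>v\<close> of the value at \<open>x\<^sup>n\<close> nearest to \<open>n t\<close> and divide it by \<open>n\<close>.\<close>
  have "\<exists>y. (x [^] (int n), of_nat n * y) \<in> g \<and> \<bar>y - t\<bar> \<le> 1 / (2 * real n)"
  proof (cases "n = 0")
    case True
    then show ?thesis using character_graphD(2)[OF g] by (intro exI[of _ t]) simp
  next
    case False
    obtain u where "(x [^] (int n), u) \<in> g" using n[of "int n"] by auto
    then obtain v where v: "(x [^] (int n), v) \<in> g" "\<bar>v - n * t\<bar> \<le> 1 / 2"
      by (rule character_graph_near[OF g])
    have "\<bar>v / n - t\<bar> = \<bar>v - n * t\<bar> / n"
      using False by (simp add: field_simps abs_divide[symmetric])
    also have "\<dots> \<le> 1 / 2 / n" using v(2) by (intro divide_right_mono) auto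
    finally show ?thesis using v(1) False by (intro exI[of _ "v / n"]) simp
  qed
  then obtain y where y: "(x [^] (int n), of_nat n * y) \<in> g" "\<bar>y - t\<bar> \<le> 1 / (2 * real n)" by blast
  define g' where
    "g' = {(x [^] k \<otimes> h, of_int k * y + u) | (k :: int) h u. (h, u) \<in> g}"
  have one: "(\<one>, 0) \<in> g" using character_graphD(2)[OF g] by simp
  have "g \<subseteq> g'"
  proof (rule subrelI)
    fix h u assume "(h, u) \<in> g"
    then show "(h, u) \<in> g'" unfolding g'_def
      using character_graphD(1)[OF g] by (force intro!: exI[of _ "0 :: int"])
  qed
  moreover have "(x, y) \<in> g'"
    unfolding g'_def using one x by (force intro!: exI[of _ "1 :: int"])
  moreover have "character_graph g'"
    unfolding character_graph_def
  proof (intro conjI allI impI)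
    show "g' \<subseteq> carrier G \<times> UNIV"
      using x character_graphD(1)[OF g] by (auto simp: g'_def)
    fix w
    show "(\<one>, w) \<in> g' \<longleftrightarrow> w \<in> \<int>"
    proof
      assume "w \<in> \<int>"
      then show "(\<one>, w) \<in> g'" using character_graphD(2)[OF g] \<open>g \<subseteq> g'\<close> by blast
    next
      assume "(\<one>, w) \<in> g'"
      then obtain k :: int and h u where k: "\<one> = x [^] k \<otimes> h" "w = of_int k * y + u" "(h, u) \<in> g"
        by (auto simp: g'_def)
      have h: "h \<in> carrier G" using k(3) character_graphD(1)[OF g] by blast
      have "x [^] k = inv h" using k(1) h x by (metis inv_equality int_pow_closed inv_inv inv_closed)
      then have hk: "(x [^] k, - u) \<in> g" using character_graph_inv[OF g k(3)] by simp
      then obtain m where m: "k = int n * m" using n by blast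
      have "((x [^] (int n)) [^] m, of_int m * (of_nat n * y)) \<in> g"
        by (rule character_graph_int_pow[OF g y(1)])
      then have "(x [^] k, of_int k * y) \<in> g"
        using x by (simp add: m int_pow_pow mult.assoc mult.left_commute)
      from character_graph_diff_Ints[OF g this hk] show "w \<in> \<int>" by (simp add: k(2))
    qed
  next
    fix p u q v assume "(p, u) \<in> g'" "(q, v) \<in> g'"
    then obtain k l :: int and p' u' q' v' where
      p: "p = x [^] k \<otimes> p'" "u = of_int k * y + u'" "(p', u') \<in> g" and
      q: "q = x [^] l \<otimes> q'" "v = of_int l * y + v'" "(q', v') \<in> g"
      by (auto simp: g'_def)
    have car: "p' \<in> carrier G" "q' \<in> carrier G" using p(3) q(3) character_graphD(1)[OF g] by auto
    have "p \<otimes> inv q = x [^] (k - l) \<otimes> (p' \<otimes> inv q')"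
      using car x by (simp add: p q int_pow_diff inv_mult m_ac)
    moreover have "u - v = of_int (k - l) * y + (u' - v')"
      by (simp add: p q algebra_simps)
    ultimately show "(p \<otimes> inv q, u - v) \<in> g'"
      unfolding g'_def using character_graphD(3)[OF g p(3) q(3)] by blast
  qed
  moreover have "Domain g' \<subseteq> {x [^] (k :: int) \<otimes> h | k h. h \<in> Domain g}"
    by (auto simp: g'_def)
  ultimately show thesis using that y(2) by blast
qed

text \<open>
  The transfinite construction. Zorn's lemma is applied to the characters that meet the bound at all
  \<open>d\<^sub>\<alpha>\<close> in their domain and whose domain lies in \<open>H\<^sub>\<alpha>\<close> whenever it omits \<open>d\<^sub>\<alpha>\<close>. The second condition
  replaces the bookkeeping of stages: if \<open>\<alpha>\<close> is the least index omitted by a maximal such character,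
  it forces the domain to be exactly \<open>H\<^sub>\<alpha>\<close>, so that the order of \<open>d\<^sub>\<alpha>\<close> modulo the domain is the
  relative order, and it survives both unions of chains and the extension to \<open>d\<^sub>\<alpha>\<close>.
\<close>

lemma character_graph_near_targets:
  fixes t :: "'i \<Rightarrow> real" and n :: "'i \<Rightarrow> nat"
  assumes W: "Well_order W" and d: "d ` Field W \<subseteq> carrier G"
    and n: "\<And>\<alpha> k. \<alpha> \<in> Field W \<Longrightarrow>
      d \<alpha> [^] (k :: int) \<in> initial_span G W d \<alpha> \<longleftrightarrow> int (n \<alpha>) dvd k"
  obtains g where "character_graph g"
    "\<And>\<alpha>. \<alpha> \<in> Field W \<Longrightarrow> \<exists>y. (d \<alpha>, y) \<in> g \<and> \<bar>y - t \<alpha>\<bar> \<le> 1 / (2 * real (n \<alpha>))"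
proof -
  define H where "H = initial_span G W d"
  have sub: "d ` underS W \<alpha> \<subseteq> carrier G" for \<alpha>
    using d Order_Relation.underS_Field[of W \<alpha>] by blast
  have H: "subgroup (H \<alpha>) G" for \<alpha>
    unfolding H_def initial_span_def by (rule generate_is_subgroup[OF sub])
  define good where "good g \<longleftrightarrow> character_graph g \<and>
    (\<forall>\<alpha>\<in>Field W. if d \<alpha> \<in> Domain g then \<exists>y. (d \<alpha>, y) \<in> g \<and> \<bar>y - t \<alpha>\<bar> \<le> 1 / (2 * real (n \<alpha>))
       else Domain g \<subseteq> H \<alpha>)" for g
  \<comment> \<open>If \<open>d\<^sub>\<alpha>\<close> lies in \<open>H\<^sub>\<alpha>\<close>, its relative order is 1 and the bound \<open>1/2\<close> holds for a suitable
    representative of whatever value the character has there. This covers the \<open>d\<^sub>\<alpha>\<close> that enter the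
    domain ahead of their turn.\<close>
  have good_span: "\<exists>y. (d \<alpha>, y) \<in> g \<and> \<bar>y - t \<alpha>\<bar> \<le> 1 / (2 * real (n \<alpha>))"
    if g: "character_graph g" and \<alpha>: "\<alpha> \<in> Field W" "d \<alpha> \<in> H \<alpha>" "d \<alpha> \<in> Domain g" for g \<alpha>
  proof -
    have "d \<alpha> [^] (1 :: int) \<in> H \<alpha>" using \<alpha> d by auto
    then have "n \<alpha> = 1" using n[OF \<alpha>(1), of 1] by (simp add: H_def)
    moreover obtain u where "(d \<alpha>, u) \<in> g" using \<alpha>(3) by blast
    then obtain y where "(d \<alpha>, y) \<in> g" "\<bar>y - t \<alpha>\<bar> \<le> 1 / 2"
      by (rule character_graph_near[OF g])
    ultimately show ?thesis by (intro exI[of _ y]) simp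
  qed
  have "\<exists>M\<in>Collect good. \<forall>X\<in>Collect good. M \<subseteq> X \<longrightarrow> X = M"
  proof (rule subset_Zorn_nonempty)
    have "good ({\<one>} \<times> \<int>)"
      unfolding good_def
    proof (intro conjI ballI character_graph_singleton)
      fix \<alpha> assume "\<alpha> \<in> Field W"
      moreover have "Domain ({\<one>} \<times> (\<int> :: real set)) = {\<one>}" by auto
      ultimately show "if d \<alpha> \<in> Domain ({\<one>} \<times> \<int>)
        then \<exists>y. (d \<alpha>, y) \<in> {\<one>} \<times> \<int> \<and> \<bar>y - t \<alpha>\<bar> \<le> 1 / (2 * real (n \<alpha>))
        else Domain ({\<one>} \<times> (\<int> :: real set)) \<subseteq> H \<alpha>"
        using good_span[OF character_graph_singleton, of \<alpha>] subgroup.one_closed[OF H] by auto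
    qed
    then show "Collect good \<noteq> {}" by blast
  next
    fix C assume C: "C \<noteq> {}" "subset.chain (Collect good) C"
    then have gd: "good g" if "g \<in> C" for g using that by (auto simp: subset_chain_def)
    have "character_graph (\<Union>C)"
      using C gd by (intro character_graph_Union) (auto simp: subset_chain_def good_def)
    moreover have "if d \<alpha> \<in> Domain (\<Union>C)
        then \<exists>y. (d \<alpha>, y) \<in> \<Union>C \<and> \<bar>y - t \<alpha>\<bar> \<le> 1 / (2 * real (n \<alpha>))
        else Domain (\<Union>C) \<subseteq> H \<alpha>" if "\<alpha> \<in> Field W" for \<alpha>
    proof (cases "d \<alpha> \<in> Domain (\<Union>C)")
      case True
      then obtain g where "g \<in> C" "d \<alpha> \<in> Domain g" by blast
      then have "\<exists>y. (d \<alpha>, y) \<in> g \<and> \<bar>y - t \<alpha>\<bar> \<le> 1 / (2 * real (n \<alpha>))"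
        using gd[of g] that by (simp add: good_def)
      with \<open>g \<in> C\<close> True show ?thesis by auto
    next
      case False
      then have "Domain g \<subseteq> H \<alpha>" if "g \<in> C" for g
      proof -
        have "d \<alpha> \<notin> Domain g" using that False by blast
        then show ?thesis using gd[OF that] \<open>\<alpha> \<in> Field W\<close> by (auto simp: good_def)
      qed
      then have "Domain (\<Union>C) \<subseteq> H \<alpha>" by blast
      with False show ?thesis by simp
    qed
    ultimately show "\<Union>C \<in> Collect good" unfolding good_def by blast
  qed
  then obtain M where M: "good M" and max: "\<And>X. good X \<Longrightarrow> M \<subseteq> X \<Longrightarrow> X = M" by auto
  have cM: "character_graph M" using M by (simp add: good_def)
  have "d ` Field W \<subseteq> Domain M"
  proof (rule ccontr)
    assume "\<not> d ` Field W \<subseteq> Domain M"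
    then have "{\<beta> \<in> Field W. d \<beta> \<notin> Domain M} \<noteq> {}" by blast
    moreover have W_rel: "wo_rel W" using W by (simp add: wo_rel_def)
    ultimately have "\<exists>\<alpha>. wo_rel.isMinim W {\<beta> \<in> Field W. d \<beta> \<notin> Domain M} \<alpha>"
      by (intro wo_rel.Well_order_isMinim_exists) auto
    then obtain \<alpha> where \<alpha>: "\<alpha> \<in> Field W" "d \<alpha> \<notin> Domain M"
      and least: "\<And>\<beta>. \<beta> \<in> Field W \<Longrightarrow> d \<beta> \<notin> Domain M \<Longrightarrow> (\<alpha>, \<beta>) \<in> W"
      unfolding wo_rel.isMinim_def[OF W_rel] by blast
    have sM: "subgroup (Domain M) G"
    proof (rule subgroupI)
      show "Domain M \<subseteq> carrier G" using character_graphD(1)[OF cM] by blast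
      show "Domain M \<noteq> {}" using character_graphD(2)[OF cM] Ints_0 by blast
      show "inv a \<in> Domain M" if "a \<in> Domain M" for a
        using character_graph_inv[OF cM] that by blast
      show "a \<otimes> b \<in> Domain M" if "a \<in> Domain M" "b \<in> Domain M" for a b
        using character_graph_mult[OF cM] that by blast
    qed
    have anti: "antisym W" and tr: "trans W"
      using W by (auto simp: order_on_defs)
    have "H \<alpha> \<subseteq> Domain M"
      unfolding H_def initial_span_def
    proof (rule generate_subgroup_incl[OF _ sM], clarify)
      fix \<beta> assume \<beta>: "\<beta> \<in> underS W \<alpha>"
      then have "(\<alpha>, \<beta>) \<notin> W" using anti by (auto simp: underS_def antisym_def)
      moreover have "\<beta> \<in> Field W" using \<beta> Order_Relation.underS_Field[of W] by blast
      ultimately show "d \<beta> \<in> Domain M" using least by blast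
    qed
    moreover have "Domain M \<subseteq> H \<alpha>" using M \<alpha> by (auto simp: good_def split: if_splits)
    ultimately have DM: "Domain M = H \<alpha>" by blast
    have dc: "d \<alpha> \<in> carrier G" using d \<alpha> by blast
    have ord: "d \<alpha> [^] (k :: int) \<in> Domain M \<longleftrightarrow> int (n \<alpha>) dvd k" for k
      unfolding DM H_def by (rule n[OF \<alpha>(1)])
    obtain g' y where g': "character_graph g'" "M \<subseteq> g'" "(d \<alpha>, y) \<in> g'"
      "\<bar>y - t \<alpha>\<bar> \<le> 1 / (2 * real (n \<alpha>))"
      "Domain g' \<subseteq> {d \<alpha> [^] (k :: int) \<otimes> h | k h. h \<in> Domain M}"
      by (rule character_graph_extend[OF cM dc ord])
    have later: "Domain g' \<subseteq> H \<beta>" if "(\<alpha>, \<beta>) \<in> W" "\<beta> \<noteq> \<alpha>" for \<beta>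
    proof -
      have "\<alpha> \<in> underS W \<beta>" using that by (auto simp: underS_def)
      then have "d \<alpha> \<in> H \<beta>" unfolding H_def initial_span_def by (intro generate.incl imageI)
      have "underS W \<alpha> \<subseteq> underS W \<beta>"
        using underS_incr[OF tr anti that(1)] .
      then have "H \<alpha> \<subseteq> H \<beta>"
        unfolding H_def initial_span_def by (intro mono_generate image_mono)
      then have "d \<alpha> [^] (k :: int) \<otimes> h \<in> H \<beta>" if "h \<in> Domain M" for k h
        using that \<open>d \<alpha> \<in> H \<beta>\<close> unfolding DM
        by (intro subgroup.m_closed[OF H] subgroup_int_pow_closed[OF H]) auto
      then show ?thesis using g'(5) by blast
    qed
    have "good g'"
      unfolding good_def
    proof (intro conjI ballI g'(1))
      fix \<beta> assume \<beta>: "\<beta> \<in> Field W"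
      show "if d \<beta> \<in> Domain g' then \<exists>y. (d \<beta>, y) \<in> g' \<and> \<bar>y - t \<beta>\<bar> \<le> 1 / (2 * real (n \<beta>))
        else Domain g' \<subseteq> H \<beta>"
      proof (cases "d \<beta> \<in> Domain M")
        case True
        then have "\<exists>y. (d \<beta>, y) \<in> M \<and> \<bar>y - t \<beta>\<bar> \<le> 1 / (2 * real (n \<beta>))"
          using M \<beta> by (auto simp: good_def)
        then show ?thesis using True g'(2) by auto
      next
        case False
        then have "(\<alpha>, \<beta>) \<in> W" using least \<beta> by blast
        show ?thesis
        proof (cases "\<beta> = \<alpha>")
          case True
          then show ?thesis using g'(3,4) by auto
        next
          case False
          with \<open>(\<alpha>, \<beta>) \<in> W\<close> have "Domain g' \<subseteq> H \<beta>" by (rule later)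
          then show ?thesis using good_span[OF g'(1) \<beta>] by auto
        qed
      qed
    qed
    with max g'(2) have "g' = M" by blast
    with g'(3) \<alpha>(2) show False by blast
  qed
  then have "\<exists>y. (d \<alpha>, y) \<in> M \<and> \<bar>y - t \<alpha>\<bar> \<le> 1 / (2 * real (n \<alpha>))" if "\<alpha> \<in> Field W" for \<alpha>
  proof -
    have "d \<alpha> \<in> Domain M" using \<open>d ` Field W \<subseteq> Domain M\<close> that by blast
    then show ?thesis using M that by (simp add: good_def)
  qed
  with cM show thesis by (rule that)
qed

text \<open>
  On each coset of the domain, translate the character by a fixed representative. This transports
  the increments of the character to the whole group without extending it as a homomorphism.
\<close>

lemma character_graph_potential:
  assumes g: "character_graph g"
  obtains \<Phi> :: "'a \<Rightarrow> real" where
    "\<And>b x y. b \<in> carrier G \<Longrightarrow> (x, y) \<in> g \<Longrightarrow> \<Phi> (b \<otimes> x) - \<Phi> b - y \<in> \<int>"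
proof
  \<comment> \<open>\<open>K b\<close> is the coset of \<open>b\<close>; choosing \<open>p b\<close> through \<open>K b\<close> makes it depend on the coset only.\<close>
  define K where "K b = {x \<in> carrier G. b \<otimes> inv x \<in> Domain g}" for b
  define p where "p b = (SOME x. x \<in> K b)" for b
  define \<Phi> where "\<Phi> b = (SOME u. (b \<otimes> inv (p b), u) \<in> g)" for b
  have p: "p b \<in> K b" if "b \<in> carrier G" for b
  proof -
    have "b \<in> K b" using that character_graphD(2)[OF g] Ints_0 by (auto simp: K_def)
    then show ?thesis unfolding p_def by (rule someI)
  qed
  have \<Phi>: "(b \<otimes> inv (p b), \<Phi> b) \<in> g" if "b \<in> carrier G" for b
    unfolding \<Phi>_def by (rule someI_ex) (use p[OF that] in \<open>auto simp: K_def\<close>)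
  fix b x y assume b: "b \<in> carrier G" and xy: "(x, y) \<in> g"
  have x: "x \<in> carrier G" using character_graphD(1)[OF g xy] .
  have "K (b \<otimes> x) = K b"
  proof -
    have "b \<otimes> x \<otimes> inv z \<in> Domain g \<longleftrightarrow> b \<otimes> inv z \<in> Domain g" if z: "z \<in> carrier G" for z
    proof
      assume "b \<otimes> x \<otimes> inv z \<in> Domain g"
      then obtain u where "(b \<otimes> x \<otimes> inv z, u) \<in> g" by blast
      from character_graphD(3)[OF g this xy] have "b \<otimes> x \<otimes> inv z \<otimes> inv x \<in> Domain g" by blast
      moreover have "b \<otimes> x \<otimes> inv z \<otimes> inv x = x \<otimes> inv x \<otimes> (b \<otimes> inv z)"
        using b x z by (simp only: m_ac inv_closed m_closed)
      ultimately show "b \<otimes> inv z \<in> Domain g" using b x z by simp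
    next
      assume "b \<otimes> inv z \<in> Domain g"
      then obtain u where "(b \<otimes> inv z, u) \<in> g" by blast
      from character_graph_mult[OF g this xy] have "b \<otimes> inv z \<otimes> x \<in> Domain g" by blast
      then show "b \<otimes> x \<otimes> inv z \<in> Domain g" using b x z by (simp add: m_ac)
    qed
    then show ?thesis by (auto simp: K_def)
  qed
  then have pp: "p (b \<otimes> x) = p b" by (simp add: p_def)
  have pc: "p b \<in> carrier G" using p[OF b] by (simp add: K_def)
  have "(b \<otimes> x \<otimes> inv (p b), \<Phi> (b \<otimes> x)) \<in> g" using \<Phi>[of "b \<otimes> x"] b x pp by simp
  moreover have "(b \<otimes> x \<otimes> inv (p b), \<Phi> b + y) \<in> g"
    using character_graph_mult[OF g \<Phi>[OF b] xy] b x pc by (simp add: m_ac)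
  ultimately show "\<Phi> (b \<otimes> x) - \<Phi> b - y \<in> \<int>"
    using character_graph_diff_Ints[OF g] by (metis diff_diff_eq)
qed

section \<open>Relative orders\<close>

text \<open>
  Since \<open>ord\<close> is 0 on elements of infinite order and only 0 is divisible by 0, divisibility by
  \<open>ord\<close> covers finite and infinite relative orders alike.
\<close>

lemma int_pow_mem_iff_ord_dvd:
  assumes "subgroup H G" "x \<in> carrier G"
  shows "x [^] (k :: int) \<in> H \<longleftrightarrow> int (group.ord (G Mod H) (H #> x)) dvd k"
proof -
  interpret N: normal H G using subgroup_imp_normal[OF assms(1)] .
  interpret Q: group "G Mod H" by (rule N.factorgroup_is_group)
  have "H #> x \<in> carrier (G Mod H)" using assms by (auto simp: carrier_FactGroup)
  then have "int (Q.ord (H #> x)) dvd k \<longleftrightarrow> (H #> x) [^]\<^bsub>G Mod H\<^esub> k = H"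
    using Q.int_pow_eq_id by simp
  also have "\<dots> \<longleftrightarrow> H #> x [^] k = H" using N.FactGroup_int_pow[OF assms(2)] by simp
  also have "\<dots> \<longleftrightarrow> x [^] k \<in> H"
    using assms coset_join1[of H "x [^] k"] coset_join2[of "x [^] k" H] by auto
  finally show ?thesis ..
qed

lemma relative_order_ge_2:
  assumes "d ` underS W \<alpha> \<subseteq> carrier G" "d \<alpha> \<in> carrier G" "d \<alpha> \<notin> initial_span G W d \<alpha>"
  shows "relative_order G W d \<alpha> \<ge> 2"
proof -
  let ?H = "initial_span G W d \<alpha>"
  let ?o = "group.ord (G Mod ?H) (?H #> d \<alpha>)"
  have "subgroup ?H G" unfolding initial_span_def by (rule generate_is_subgroup[OF assms(1)])
  from int_pow_mem_iff_ord_dvd[OF this assms(2), of 1] have "?o \<noteq> 1" using assms(2,3) by auto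
  then have "?o = 0 \<or> 2 \<le> ?o" by linarith
  then show ?thesis
    by (auto simp: relative_order_def element_order_def Let_def numeral_eq_enat)
qed

section \<open>Semiminimal families of generalized dihedral groups\<close>

lemma Dih_simps:
  "(a, e) \<in> carrier (Dih G) \<longleftrightarrow> a \<in> carrier G"
  "(a, e) \<otimes>\<^bsub>Dih G\<^esub> (b, e') = (a \<otimes> (if e then inv b else b), e \<noteq> e')"
  by (auto simp: Dih_def)

text \<open>
  A rotation \<open>c\<^sub>\<beta>\<close> is \<open>d\<^sub>\<beta>\<close> itself, and for a reflection \<open>c\<^sub>\<beta>\<close> the product \<open>c\<^sub>\<beta> c\<^sub>s\<close> is the rotation by
  \<open>d\<^sub>\<beta>\<close>. The hypothesis on \<open>S\<close> makes \<open>c\<^sub>s\<close> available exactly when a reflection needs it.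
\<close>

lemma reduced_family_generate_Dih:
  assumes S: "c ` S \<subseteq> carrier (Dih G)" and cs: "snd (c s)"
    and refl: "\<And>\<beta>. \<beta> \<in> S \<Longrightarrow> snd (c \<beta>) \<Longrightarrow> s \<in> S"
    and x: "x \<in> generate G (reduced_family G c s ` S)"
  shows "(x, False) \<in> generate (Dih G) (c ` S)"
proof -
  interpret D: group "Dih G" by (rule group_Dih)
  have sub: "subgroup (generate (Dih G) (c ` S)) (Dih G)" by (rule D.generate_is_subgroup[OF S])
  have car: "fst (c \<beta>) \<in> carrier G" if "\<beta> \<in> S" for \<beta>
    using S that by (cases "c \<beta>") (force simp: Dih_simps)
  have red: "(reduced_family G c s \<beta>, False) \<in> generate (Dih G) (c ` S)"
    "reduced_family G c s \<beta> \<in> carrier G" if \<beta>: "\<beta> \<in> S" for \<beta>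
  proof -
    have "(reduced_family G c s \<beta>, False) \<in> generate (Dih G) (c ` S) \<and>
      reduced_family G c s \<beta> \<in> carrier G"
    proof (cases "snd (c \<beta>)")
      case True
      have "c \<beta> \<otimes>\<^bsub>Dih G\<^esub> c s \<in> generate (Dih G) (c ` S)"
        using \<beta> refl[OF \<beta> True] by (auto intro: generate.eng generate.incl)
      moreover have "c \<beta> \<otimes>\<^bsub>Dih G\<^esub> c s = (reduced_family G c s \<beta>, False)"
        using True cs by (cases "c \<beta>"; cases "c s") (auto simp: Dih_simps reduced_family_def)
      ultimately show ?thesis using car[OF \<beta>] car[OF refl[OF \<beta> True]] True
        by (simp add: reduced_family_def)
    next
      case False
      then have "c \<beta> = (reduced_family G c s \<beta>, False)"
        using car[OF \<beta>] by (cases "c \<beta>") (auto simp: reduced_family_def)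
      then show ?thesis using \<beta> car[OF \<beta>] by (metis fst_conv generate.incl imageI)
    qed
    then show "(reduced_family G c s \<beta>, False) \<in> generate (Dih G) (c ` S)"
      "reduced_family G c s \<beta> \<in> carrier G" by auto
  qed
  have inv: "inv\<^bsub>Dih G\<^esub> (a, False) = (inv a, False)" if "a \<in> carrier G" for a
    using that by (intro D.inv_equality) (auto simp: Dih_simps Dih_def)
  show ?thesis using x
  proof induction
    case one
    show ?case using generate.one[of "Dih G"] by (simp add: Dih_def)
  next
    case (incl h)
    then show ?case using red by auto
  next
    case (inv h)
    then obtain \<beta> where \<beta>: "\<beta> \<in> S" "h = reduced_family G c s \<beta>" by auto
    show ?case using subgroup.m_inv_closed[OF sub red(1)[OF \<beta>(1)]] inv red(2)[OF \<beta>(1)] \<beta>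
      \<open>\<And>a. a \<in> carrier G \<Longrightarrow> inv\<^bsub>Dih G\<^esub> (a, False) = (inv a, False)\<close> by simp
  next
    case (eng h1 h2)
    then show ?case using generate.eng[OF eng(3,4)] by (simp add: Dih_simps)
  qed
qed

text \<open>
  If \<open>d\<^sub>\<alpha>\<close> were a combination of earlier \<open>d\<^sub>\<beta>\<close>, then the rotation by \<open>d\<^sub>\<alpha>\<close> would be a product of earlier
  \<open>c\<^sub>\<beta>\<close>, and so would \<open>c\<^sub>\<alpha>\<close>, which is that rotation or its product with \<open>c\<^sub>s\<close>. Minimality of \<open>s\<close>
  ensures that \<open>c\<^sub>s\<close> precedes every other reflection.
\<close>

lemma reduced_family_semiminimal:
  assumes c: "semiminimal_family (Dih G) W c"
    and s: "s \<in> Field W" "snd (c s)" "\<forall>\<beta>\<in>Field W. snd (c \<beta>) \<longrightarrow> (s, \<beta>) \<in> W"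
  shows "semiminimal_family G (Restr W (Field W - {s})) (reduced_family G c s)"
proof -
  interpret D: group "Dih G" by (rule group_Dih)
  let ?W = "Restr W (Field W - {s})"
  have W: "Well_order W" and cc: "c ` Field W \<subseteq> carrier (Dih G)"
    and nm: "\<And>\<alpha>. \<alpha> \<in> Field W \<Longrightarrow> c \<alpha> \<notin> generate (Dih G) (c ` underS W \<alpha>)"
    using c by (auto simp: semiminimal_family_def initial_span_def)
  have F: "Field ?W = Field W - {s}"
    using W by (intro Refl_Field_Restr2) (auto simp: order_on_defs)
  have car: "fst (c \<beta>) \<in> carrier G" if "\<beta> \<in> Field W" for \<beta>
    using cc that by (cases "c \<beta>") (force simp: Dih_simps)
  have red: "reduced_family G c s \<beta> \<in> carrier G" if "\<beta> \<in> Field W" for \<beta>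
    using car[OF that] car[OF s(1)] by (simp add: reduced_family_def)
  have "reduced_family G c s \<alpha> \<notin> generate G (reduced_family G c s ` underS ?W \<alpha>)"
    if \<alpha>: "\<alpha> \<in> Field W" "\<alpha> \<noteq> s" for \<alpha>
  proof
    assume "reduced_family G c s \<alpha> \<in> generate G (reduced_family G c s ` underS ?W \<alpha>)"
    moreover have "underS ?W \<alpha> \<subseteq> underS W \<alpha>" by (auto simp: underS_def)
    ultimately have x: "reduced_family G c s \<alpha> \<in> generate G (reduced_family G c s ` underS W \<alpha>)"
      using mono_generate[of "reduced_family G c s ` underS ?W \<alpha>" "reduced_family G c s ` underS W \<alpha>"]
      by blast
    have sub: "underS W \<alpha> \<subseteq> Field W" by (rule Order_Relation.underS_Field)
    have tr: "trans W" and anti: "antisym W" using W by (auto simp: order_on_defs)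
    have below: "s \<in> underS W \<alpha>" if "\<beta> \<in> underS W \<alpha>" "snd (c \<beta>)" for \<beta>
    proof -
      have "(s, \<beta>) \<in> W" using s(3) that sub by blast
      moreover have "(\<beta>, \<alpha>) \<in> W" using that by (simp add: underS_def)
      ultimately show ?thesis using tr \<alpha>(2) by (auto simp: underS_def dest: transD)
    qed
    have rot: "(reduced_family G c s \<alpha>, False) \<in> generate (Dih G) (c ` underS W \<alpha>)"
      using sub cc by (intro reduced_family_generate_Dih[OF _ s(2) below x]) auto
    show False
    proof (cases "snd (c \<alpha>)")
      case True
      then have "s \<in> underS W \<alpha>" using s(3) \<alpha> by (auto simp: underS_def)
      then have "(reduced_family G c s \<alpha>, False) \<otimes>\<^bsub>Dih G\<^esub> c s \<in> generate (Dih G) (c ` underS W \<alpha>)"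
        using rot by (auto intro: generate.eng generate.incl)
      moreover have "(reduced_family G c s \<alpha>, False) \<otimes>\<^bsub>Dih G\<^esub> c s = c \<alpha>"
        using True s(2) car[OF \<alpha>(1)] car[OF s(1)]
        by (cases "c \<alpha>"; cases "c s") (auto simp: Dih_simps reduced_family_def m_assoc)
      ultimately show False using nm[OF \<alpha>(1)] by simp
    next
      case False
      then have "c \<alpha> = (reduced_family G c s \<alpha>, False)"
        using car[OF \<alpha>(1)] by (cases "c \<alpha>") (auto simp: reduced_family_def)
      then show False using rot nm[OF \<alpha>(1)] by simp
    qed
  qed
  then show ?thesis
    using Well_order_Restr[OF W, of "Field W - {s}"] red
    unfolding semiminimal_family_def initial_span_def F by auto
qed

end

section \<open>Circular colourings\<close>

lemma circle_norm_abs_diff: "circle_norm (abs_circle x - abs_circle y) = infdist (x - y) \<int>"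
  by (simp add: minus_circle.abs_eq circle_norm.abs_eq)

lemma infdist_Ints_ge:
  fixes x y \<delta> :: real
  assumes "x - y \<in> \<int>" "\<bar>y - 1 / 2\<bar> \<le> \<delta>"
  shows "infdist x \<int> \<ge> 1 / 2 - \<delta>"
proof -
  have "1 / 2 - \<delta> \<le> dist x m" if m: "m \<in> \<int>" for m
  proof -
    obtain k where "x - y = of_int k" using assms(1) by (auto elim: Ints_cases)
    moreover obtain l where "m = of_int l" using m by (auto elim: Ints_cases)
    ultimately have k: "x - m = y + of_int (k - l)" by simp
    have "real_of_int l \<le> real_of_int k \<or> real_of_int k + 1 \<le> real_of_int l"
      by (cases "l \<le> k") (simp_all add: int_less_real_le[symmetric])
    then show ?thesis using k assms(2) unfolding dist_real_def of_int_diff by linarith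
  qed
  moreover have "(\<int> :: real set) \<noteq> {}" using Ints_0 by blast
  ultimately show ?thesis by (simp add: infdist_def cINF_greatest)
qed

lemma infdist_Ints_minus: "infdist (- x) \<int> = infdist (x :: real) \<int>"
proof -
  have le: "infdist (- x) \<int> \<le> infdist x \<int>" for x :: real
  proof -
    have "infdist (- x) \<int> \<le> dist x m" if "m \<in> \<int>" for m
      using infdist_le[of "- m" \<int> "- x"] that by (simp add: dist_real_def abs_minus_commute)
    moreover have "(\<int> :: real set) \<noteq> {}" using Ints_0 by blast
    ultimately show ?thesis by (simp add: infdist_def[of x] cINF_greatest)
  qed
  from le[of x] le[of "- x"] show ?thesis by simp
qed

lemma circular_coloring_CayI:
  assumes G: "group G" and S: "S \<subseteq> carrier G"
    and edge: "\<And>a x. a \<in> carrier G \<Longrightarrow> x \<in> S \<Longrightarrow>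
      infdist (f (a \<otimes>\<^bsub>G\<^esub> x) - f a) \<int> \<ge> 1 / q"
  shows "circular_coloring (Cay G S) q (\<lambda>v. abs_circle (f v))"
proof -
  interpret group G by fact
  have half: "infdist (f b - f a) \<int> \<ge> 1 / q \<and> infdist (f a - f b) \<int> \<ge> 1 / q"
    if ab: "a \<in> carrier G" "b \<in> carrier G" "inv\<^bsub>G\<^esub> a \<otimes>\<^bsub>G\<^esub> b \<in> S \<union> m_inv G ` S" for a b
  proof -
    have "infdist (f b - f a) \<int> \<ge> 1 / q \<or> infdist (f a - f b) \<int> \<ge> 1 / q"
      using ab(3)
    proof
      assume "inv\<^bsub>G\<^esub> a \<otimes>\<^bsub>G\<^esub> b \<in> S"
      from edge[OF ab(1) this] show ?thesis using ab by (simp flip: m_assoc)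
    next
      assume "inv\<^bsub>G\<^esub> a \<otimes>\<^bsub>G\<^esub> b \<in> m_inv G ` S"
      then obtain x where x: "x \<in> S" "inv\<^bsub>G\<^esub> a \<otimes>\<^bsub>G\<^esub> b = inv\<^bsub>G\<^esub> x" by blast
      have "x = inv\<^bsub>G\<^esub> b \<otimes>\<^bsub>G\<^esub> a"
        using x S ab by (metis inv_closed inv_inv inv_mult_group subsetD)
      then have "b \<otimes>\<^bsub>G\<^esub> x = a" using ab by (simp flip: m_assoc)
      then show ?thesis using edge[OF ab(2) x(1)] by simp
    qed
    then show ?thesis using infdist_Ints_minus[of "f a - f b"] by simp
  qed
  show ?thesis
    unfolding circular_coloring_def circle_norm_abs_diff
    using half by (auto simp: Cay_def doubleton_eq_iff)
qed

text \<open>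
  The colour of \<open>(b, \<epsilon>)\<close> is \<open>\<Phi> (b - \<epsilon> a\<^sub>s) + \<epsilon>/2\<close>, where \<open>\<Phi>\<close> has the increments of a character near the
  targets \<open>1/2\<close> at rotations and \<open>0\<close> at reflections. Then every generator changes the colour by
  an amount within \<open>\<delta>\<close> of \<open>1/2\<close>, up to sign. As before, \<open>n \<alpha> = 0\<close> encodes infinite relative order.
\<close>

theorem (in comm_group) circular_coloring_Cay_Dih:
  fixes \<delta> :: real and n :: "'i \<Rightarrow> nat"
  assumes c: "c ` I \<subseteq> carrier (Dih G)" and s: "s \<in> I" "snd (c s)" and \<delta>: "0 \<le> \<delta>"
    and W: "Well_order W" "Field W = I - {s}"
    and n: "\<And>\<alpha> k. \<alpha> \<in> I - {s} \<Longrightarrow>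
      reduced_family G c s \<alpha> [^] (k :: int) \<in> initial_span G W (reduced_family G c s) \<alpha>
        \<longleftrightarrow> int (n \<alpha>) dvd k"
    and n\<delta>: "\<And>\<alpha>. \<alpha> \<in> I - {s} \<Longrightarrow> 1 / (2 * real (n \<alpha>)) \<le> \<delta>"
  shows "\<exists>f. circular_coloring (Cay (Dih G) (c ` I)) (1 / (1 / 2 - \<delta>)) f"
proof -
  let ?d = "reduced_family G c s"
  define a where "a = fst (c s)"
  have car: "fst (c \<beta>) \<in> carrier G" if "\<beta> \<in> I" for \<beta>
    using c that by (cases "c \<beta>") (force simp: Dih_simps)
  have a: "a \<in> carrier G" using car[OF s(1)] by (simp add: a_def)
  have d: "?d \<alpha> \<in> carrier G" if "\<alpha> \<in> I" for \<alpha>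
    using car[OF that] a by (simp add: reduced_family_def a_def)
  obtain g where g: "character_graph g" and near: "\<And>\<alpha>. \<alpha> \<in> I - {s} \<Longrightarrow>
      \<exists>y. (?d \<alpha>, y) \<in> g \<and> \<bar>y - (if snd (c \<alpha>) then 0 else 1 / 2)\<bar> \<le> 1 / (2 * real (n \<alpha>))"
  proof (rule character_graph_near_targets[OF W(1), of ?d n "\<lambda>\<alpha>. if snd (c \<alpha>) then 0 else 1 / 2"])
    show "?d ` Field W \<subseteq> carrier G" using d W(2) by auto
  qed (use n W(2) that in auto)
  obtain \<Phi> :: "'a \<Rightarrow> real" where
    \<Phi>: "\<And>b x y. b \<in> carrier G \<Longrightarrow> (x, y) \<in> g \<Longrightarrow> \<Phi> (b \<otimes> x) - \<Phi> b - y \<in> \<int>"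
  proof (rule character_graph_potential[OF g])
    fix \<Phi> :: "'a \<Rightarrow> real"
    assume "\<And>b x y. b \<in> carrier G \<Longrightarrow> (x, y) \<in> g \<Longrightarrow> \<Phi> (b \<otimes> x) - \<Phi> b - y \<in> \<int>"
    then show thesis by (rule that)
  qed
  define h :: "bool \<Rightarrow> real" where "h e = (if e then 1 / 2 else 0)" for e
  have step: "infdist (\<Phi> (b \<otimes> ?d \<alpha>) - \<Phi> b + h (snd (c \<alpha>))) \<int> \<ge> 1 / 2 - \<delta>"
    if b: "b \<in> carrier G" and \<alpha>: "\<alpha> \<in> I" for b \<alpha>
  proof -
    have "\<exists>y. (?d \<alpha>, y) \<in> g \<and> \<bar>y + h (snd (c \<alpha>)) - 1 / 2\<bar> \<le> \<delta>"
    proof (cases "\<alpha> = s")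
      case True
      have "?d s = \<one>" using s(2) a by (simp add: reduced_family_def a_def)
      then show ?thesis
        using True character_graphD(2)[OF g, of 0] s(2) \<delta> by (intro exI[of _ 0]) (simp add: h_def)
    next
      case False
      with near[of \<alpha>] n\<delta>[of \<alpha>] \<alpha> show ?thesis by (fastforce simp: h_def split: if_splits)
    qed
    then obtain y where y: "(?d \<alpha>, y) \<in> g" "\<bar>y + h (snd (c \<alpha>)) - 1 / 2\<bar> \<le> \<delta>" by blast
    show ?thesis by (rule infdist_Ints_ge[OF _ y(2)]) (use \<Phi>[OF b y(1)] in simp)
  qed
  \<comment> \<open>The rotation part after the automorphism that moves \<open>c\<^sub>s\<close> to the unit reflection. Multiplying on
    the right by \<open>c\<^sub>\<alpha>\<close> adds \<open>d\<^sub>\<alpha>\<close> to it at a rotation and subtracts \<open>d\<^sub>\<alpha>\<close> at a reflection, hence the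
    two cases below.\<close>
  define p where "p = (\<lambda>(b, e). if e then b \<otimes> inv a else b)"
  have "circular_coloring (Cay (Dih G) (c ` I)) (1 / (1 / 2 - \<delta>))
      (\<lambda>v. abs_circle (\<Phi> (p v) + h (snd v)))"
  proof (rule circular_coloring_CayI[OF group_Dih c])
    fix v x assume v: "v \<in> carrier (Dih G)" and "x \<in> c ` I"
    then obtain \<alpha> where \<alpha>: "\<alpha> \<in> I" "x = c \<alpha>" by blast
    obtain b e where be: "v = (b, e)" "b \<in> carrier G" using v by (cases v) (auto simp: Dih_simps)
    obtain a' e' where ae: "c \<alpha> = (a', e')" "a' \<in> carrier G" using car[OF \<alpha>(1)] by (cases "c \<alpha>") auto
    let ?w = "v \<otimes>\<^bsub>Dih G\<^esub> x"
    have w: "?w = (b \<otimes> (if e then inv a' else a'), e \<noteq> e')" by (simp add: be \<alpha> ae Dih_simps)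
    have da: "?d \<alpha> = (if e' then a' \<otimes> inv a else a')"
      using ae by (simp add: reduced_family_def a_def)
    have pc: "p v \<in> carrier G" "p ?w \<in> carrier G"
      unfolding w using be ae a by (auto simp: p_def)
    have "infdist (\<Phi> (p ?w) + h (snd ?w) - (\<Phi> (p v) + h (snd v))) \<int> \<ge> 1 / 2 - \<delta>"
    proof (cases e)
      case False
      then have "p ?w = p v \<otimes> ?d \<alpha>"
        unfolding w using be ae a by (simp add: p_def da m_assoc)
      moreover have "h (snd ?w) = h (snd v) + h (snd (c \<alpha>))"
        unfolding w using False by (simp add: be ae h_def)
      ultimately show ?thesis using step[OF pc(1) \<alpha>(1)] by (simp add: algebra_simps)
    next
      case True
      have "p v = p ?w \<otimes> ?d \<alpha>"
      proof (cases e')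
        case e': True
        have "b \<otimes> inv a' \<otimes> (a' \<otimes> inv a) = b \<otimes> (inv a' \<otimes> a') \<otimes> inv a"
          using be ae a by (simp only: m_assoc m_closed inv_closed)
        then show ?thesis unfolding w using True e' be ae a by (simp add: p_def da)
      next
        case False
        have "b \<otimes> inv a' \<otimes> inv a \<otimes> a' = b \<otimes> inv a \<otimes> (inv a' \<otimes> a')"
          using be ae a by (simp only: m_ac m_closed inv_closed)
        then show ?thesis unfolding w using True False be ae a by (simp add: p_def da)
      qed
      moreover have "h (snd v) = h (snd ?w) + h (snd (c \<alpha>))"
        unfolding w using True by (simp add: be ae h_def)
      ultimately have "\<Phi> (p ?w) + h (snd ?w) - (\<Phi> (p v) + h (snd v)) =
          - (\<Phi> (p ?w \<otimes> ?d \<alpha>) - \<Phi> (p ?w) + h (snd (c \<alpha>)))"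
        by simp
      then show ?thesis using step[OF pc(2) \<alpha>(1)] by (simp only: infdist_Ints_minus)
    qed
    then show "1 / (1 / (1 / 2 - \<delta>))
        \<le> infdist (\<Phi> (p ?w) + h (snd ?w) - (\<Phi> (p v) + h (snd v))) \<int>" by simp
  qed
  then show ?thesis by blast
qed

theorem theorem4p4:
  fixes A :: "('a, 'm) monoid_scheme"
    and W :: "'i rel"
    and c :: "'i \<Rightarrow> 'a \<times> bool"
    and s :: 'i
    and r :: enat
  assumes "comm_group A"
    and "semiminimal_family (Dih A) W c"
    and "s \<in> Field W" and "snd (c s)"
    and "\<forall>\<beta>\<in>Field W. snd (c \<beta>) \<longrightarrow> (s, \<beta>) \<in> W"
    and "r = family_order A (Restr W (Field W - {s})) (reduced_family A c s)"
  shows "\<chi>\<^sub>c (Cay (Dih A) (c ` Field W)) \<le>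
    (case r of \<infinity> \<Rightarrow> 2 | enat n \<Rightarrow> ereal (2 * real n / (real n - 1)))"
proof -
  interpret comm_group A by fact
  let ?W = "Restr W (Field W - {s})" and ?d = "reduced_family A c s"
  have c: "c ` Field W \<subseteq> carrier (Dih A)" and W: "Well_order W"
    using assms(2) by (auto simp: semiminimal_family_def)
  have F: "Field ?W = Field W - {s}"
    using W by (intro Refl_Field_Restr2) (auto simp: order_on_defs)
  have "semiminimal_family A ?W ?d" by (rule reduced_family_semiminimal[OF assms(2-5)])
  then have W': "Well_order ?W" and d: "?d ` Field ?W \<subseteq> carrier A"
    and nm: "\<And>\<alpha>. \<alpha> \<in> Field ?W \<Longrightarrow> ?d \<alpha> \<notin> initial_span A ?W ?d \<alpha>"
    by (auto simp: semiminimal_family_def)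
  define n where "n \<alpha> = group.ord (A Mod initial_span A ?W ?d \<alpha>)
    (initial_span A ?W ?d \<alpha> #>\<^bsub>A\<^esub> ?d \<alpha>)" for \<alpha>
  have dU: "?d ` underS ?W \<alpha> \<subseteq> carrier A" for \<alpha> using d Order_Relation.underS_Field[of ?W \<alpha>] by blast
  have n: "?d \<alpha> [^]\<^bsub>A\<^esub> (k :: int) \<in> initial_span A ?W ?d \<alpha> \<longleftrightarrow> int (n \<alpha>) dvd k"
    if "\<alpha> \<in> Field W - {s}" for \<alpha> k
    unfolding n_def using d that F
    by (intro int_pow_mem_iff_ord_dvd) (auto simp: initial_span_def intro!: generate_is_subgroup dU)
  have r_le: "r \<le> (if n \<alpha> = 0 then \<infinity> else enat (n \<alpha>))" if "\<alpha> \<in> Field W - {s}" for \<alpha>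
  proof -
    have "r \<le> relative_order A ?W ?d \<alpha>"
      unfolding assms(6) family_order_def using that F by (intro INF_lower) simp
    then show ?thesis unfolding relative_order_def element_order_def n_def Let_def .
  qed
  have r2: "2 \<le> r"
    unfolding assms(6) family_order_def
    using d by (intro INF_greatest relative_order_ge_2 dU nm) auto
  have bound: "\<chi>\<^sub>c (Cay (Dih A) (c ` Field W)) \<le> ereal (1 / (1 / 2 - \<delta>))"
    if \<delta>: "0 \<le> \<delta>" "\<delta> < 1 / 2" and n\<delta>: "\<And>\<alpha>. \<alpha> \<in> Field W - {s} \<Longrightarrow> 1 / (2 * real (n \<alpha>)) \<le> \<delta>" for \<delta>
  proof -
    have "\<exists>f. circular_coloring (Cay (Dih A) (c ` Field W)) (1 / (1 / 2 - \<delta>)) f"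
      by (rule circular_coloring_Cay_Dih[OF c assms(3,4) \<delta>(1) W' F n n\<delta>])
    moreover have "1 / (1 / 2 - \<delta>) \<ge> 1" using \<delta> by (simp add: field_simps)
    ultimately show ?thesis
      unfolding circular_chromatic_number_def by (intro Inf_lower) blast
  qed
  show ?thesis
  proof (cases r)
    case (enat m)
    then have m: "2 \<le> m" using r2 by (simp add: numeral_eq_enat)
    have "1 / (2 * real (n \<alpha>)) \<le> 1 / (2 * real m)" if "\<alpha> \<in> Field W - {s}" for \<alpha>
      using r_le[OF that] enat m by (auto simp: field_simps split: if_splits)
    then have "\<chi>\<^sub>c (Cay (Dih A) (c ` Field W)) \<le> ereal (1 / (1 / 2 - 1 / (2 * real m)))"
      using m by (intro bound) (auto simp: field_simps)
    also have "1 / (1 / 2 - 1 / (2 * real m)) = 2 * real m / (real m - 1)"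
      using m by (simp add: field_simps)
    finally show ?thesis by (simp add: enat)
  next
    case infinity
    have "1 / (2 * real (n \<alpha>)) \<le> 0" if "\<alpha> \<in> Field W - {s}" for \<alpha>
      using r_le[OF that] infinity by (auto split: if_splits)
    then show ?thesis using bound[of 0] infinity by simp
  qed
qed

end
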